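(* Let $n\geq 4$ and let $u,v,w$ be non-negative integers with $u+v+w=n+1$. (1) If $u\leq 2$ and $w\leq 2$, then the couple $(\Sigma_{2,n,2},(u,v,w))$ is realizable. (2) If $u\geq 3$ or $w\geq 3$, then the couple $(\Sigma_{2,n,2},(u,v,w))$ is not realizable.
   Context: A real univariate polynomial is called hyperbolic if all its roots are real. For a real polynomial $Q=\sum_{j=0}^d a_jx^j$ with all coefficients $a_j\neq 0$, its sign pattern is $\sigma(Q)=(\mathrm{sgn}(a_d),\mathrm{sgn}(a_{d-1}),\ldots,\mathrm{sgn}(a_0))$. For positive integers $m,n,q$ with $m+n+q=d+1$, $\Sigma_{m,n,q}$ denotes the sign pattern consisting of $m$ signs $+$ followed by $n$ signs $-$ followed by $q$ signs $+$ (so for $\Sigma_{2,n,2}$ one has $d=n+3$). A degree $d$ hyperbolic polynomial with sign pattern $\Sigma_{m,n,q}$ has (by Descartes' rule of signs) exactly two positive and $d-2$ negative roots, counted with multiplicity. For non-negative integers $u,v,w$ with $u+v+w=d-2$, the couple $(\Sigma_{m,n,q},(u,v,w))$ is called realizable if there exists a degree $d$ hyperbolic polynomial $Q$ with $\sigma(Q)=\Sigma_{m,n,q}$, the moduli of all of whose roots are distinct, such that, denoting by $\beta<\alpha$ its positive roots and by $\gamma_1<\cdots<\gamma_{d-2}$ the moduli of its negative roots, and setting $\gamma_0:=0$ and $\gamma_{d-1}:=+\infty$, one has $\gamma_u<\beta<\gamma_{u+1}$ and $\gamma_{u+v}<\alpha<\gamma_{u+v+1}$. (That is, $u$ moduli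 of negative roots are smaller than $\beta$, $v$ lie between $\beta$ and $\alpha$, and $w$ are larger than $\alpha$.) *)

theory Defs
  imports "HOL-Computational_Algebra.Computational_Algebra" "HOL-Library.Extended_Real"
begin

definition hyperbolic :: "real poly \<Rightarrow> bool" where
  "hyperbolic Q \<longleftrightarrow> (\<forall>z::complex. poly (map_poly of_real Q) z = 0 \<longrightarrow> z \<in> \<real>)"

text \<open>Signs of the coefficients, leading coefficient first; every sign is \<open>1\<close> or \<open>-1\<close>
  exactly when no coefficient up to the degree vanishes.\<close>

definition sign_pattern :: "real poly \<Rightarrow> real list" where
  "sign_pattern Q = map sgn (rev (coeffs Q))"

definition Sigma_pattern :: "nat \<Rightarrow> nat \<Rightarrow> nat \<Rightarrow> real list" where
  "Sigma_pattern m n q = replicate m 1 @ replicate n (-1) @ replicate q 1"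

text \<open>Distinctness refers to the roots counted with multiplicity, hence \<^const>\<open>rsquarefree\<close>.
  A positive and a negative root may not share their modulus either.\<close>

definition distinct_moduli :: "real poly \<Rightarrow> bool" where
  "distinct_moduli Q \<longleftrightarrow> rsquarefree Q \<and> inj_on abs {x. poly Q x = 0}"

text \<open>Meant for patterns with exactly two sign changes, such as \<^term>\<open>Sigma_pattern m n q\<close>
  with \<open>m\<close>, \<open>n\<close>, \<open>q\<close> positive. The values of \<open>\<gamma>\<close> are extended reals so that the
  convention \<open>\<gamma> (d - 1) = \<infinity>\<close> can be stated.\<close>

definition realizable :: "real list \<Rightarrow> nat \<times> nat \<times> nat \<Rightarrow> bool" where
  "realizable \<sigma> = (\<lambda>(u, v, w).
     let d = length \<sigma> - 1 in
     u + v + w = d - 2 \<and>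
     (\<exists>Q. degree Q = d \<and> hyperbolic Q \<and> sign_pattern Q = \<sigma> \<and> distinct_moduli Q \<and>
       (\<exists>(\<alpha>::real) (\<beta>::real) (\<gamma>::nat \<Rightarrow> ereal).
          {x. poly Q x = 0 \<and> x > 0} = {\<beta>, \<alpha>} \<and> \<beta> < \<alpha> \<and>
          \<gamma> ` {1..d-2} = (\<lambda>x. ereal \<bar>x\<bar>) ` {x. poly Q x = 0 \<and> x < 0} \<and>
          strict_mono_on {1..d-2} \<gamma> \<and>
          \<gamma> 0 = 0 \<and> \<gamma> (d - 1) = \<infinity> \<and>
          \<gamma> u < ereal \<beta> \<and> ereal \<beta> < \<gamma> (u + 1) \<and>
          \<gamma> (u + v) < ereal \<alpha> \<and> ereal \<alpha> < \<gamma> (u + v + 1))))"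

end

theory Submission
  imports Defs
begin

text \<open>
  For a polynomial with positive leading and constant coefficient and root set \<open>R\<close>, the third coefficients
  from either end are negative iff \<open>(\<Sum>r\<in>R. r)\<^sup>2 < (\<Sum>r\<in>R. r\<^sup>2)\<close> and
  \<open>(\<Sum>r\<in>R. 1/r)\<^sup>2 < (\<Sum>r\<in>R. (1/r)\<^sup>2)\<close>. These two conditions are
  incompatible as soon as three moduli exceed \<open>\<alpha>\<close> and there are at least two further negative roots:
  the first condition forces the other moduli to be so small that their inverses violate the second one.
  The case of three moduli below \<open>\<beta>\<close> is the same statement for the inverses of the roots.

  Conversely, if two moduli and \<open>\<alpha>\<close> are of order \<open>L\<close>, two moduli and \<open>\<beta>\<close> of order \<open>1/L\<close>, and
  the rest of order \<open>1\<close>, then both inequalities hold for large \<open>L\<close>, however \<open>\<alpha>\<close> and \<open>\<beta>\<close> are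
  placed among their neighbours. Multiplication by \<open>x + \<mu>\<close> with \<open>\<mu> > 0\<close> preserves the block structure
  of the signs as long as the third coefficients from both ends stay negative, so the whole sign pattern
  follows by adding the roots of order \<open>1\<close> one at a time.
\<close>

subsection \<open>The key inequality\<close>

lemma amgm3: 
  fixes a b c :: real assumes "a > 0" "b > 0" "c > 0"
  shows "27 * (a * b * c) \<le> (a + b + c) ^ 3"
proof -
  have "(a + b + c) ^ 3 - 27 * (a * b * c) = 
    (a + b + c) * ((a - b)\<^sup>2 + (b - c)\<^sup>2 + (a - c)\<^sup>2) / 2 + 3 * (a * (b - c)\<^sup>2 + b * (a - c)\<^sup>2 + c * (a - b)\<^sup>2)"
    by (simp add: power2_eq_square power3_eq_cube field_simps)
  moreover have "0 \<le> \<dots>" using assms by (intro add_nonneg_nonneg mult_nonneg_nonneg divide_nonneg_nonneg) auto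
  ultimately show ?thesis by linarith
qed

text \<open>The case \<alpha> = 1, with \<open>b\<close> in the role of \<beta>. Assumption
  \<open>less\<close> says that the second elementary symmetric function of a1, a2, a3, x, y, -1, -b
  is negative. This bounds \<open>x + y\<close> from above, so \<open>1/x + 1/y\<close> is large
  enough to make the same function of the inverses nonnegative.\<close>

lemma three_large_moduli_normalised:
  fixes a1 a2 a3 x y b :: real
  assumes b: "0 < b" "b < 1" and a: "1 \<le> a1" "1 \<le> a2" "1 \<le> a3" and xy: "0 < x" "0 < y"
    and less: "(a1 + a2 + a3 + x + y - 1 - b)\<^sup>2 < a1\<^sup>2 + a2\<^sup>2 + a3\<^sup>2 + x\<^sup>2 + y\<^sup>2 + 1 + b\<^sup>2"
  shows "1 + 1/b < 1/x + 1/y" (is ?A)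
    and "(1/a1)\<^sup>2 + (1/a2)\<^sup>2 + (1/a3)\<^sup>2 + (1/x)\<^sup>2 + (1/y)\<^sup>2 + 1 + (1/b)\<^sup>2
      \<le> (1/a1 + 1/a2 + 1/a3 + 1/x + 1/y - 1 - 1/b)\<^sup>2" (is ?B)
proof -
  define A where "A = a1 + a2 + a3"
  define t where "t = x + y"
  define z where "z = 1 / t"
  define w where "w = 1 / (x * y)"
  define c where "c = 1 / b"
  define g1 where "g1 = 1 / a1"
  define g2 where "g2 = 1 / a2"
  define g3 where "g3 = 1 / a3"
  define G where "G = g1 + g2 + g3"
  define G2 where "G2 = g1 * g2 + g1 * g3 + g2 * g3"
  define q where "q = 3 / A"
  define h where "h = c * (A - 3) / 2"
  \<comment> \<open>\<open>z0\<close> is the lower bound for \<open>z\<close> that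
    \<open>less\<close> will yield; \<open>h\<close> is its part due to the excess of
    \<open>A\<close> over 3.\<close>
  define z0 where "z0 = c - 1/2 + h"
  have pos: "a1 > 0" "a2 > 0" "a3 > 0" using a by auto
  have A3: "A \<ge> 3" using a by (simp add: A_def)
  have c1: "c > 1" using b by (simp add: c_def)
  have t0: "t > 0" and z_pos: "z > 0" and w_pos: "w > 0"
    using xy by (auto simp: t_def z_def w_def)
  have h0: "h \<ge> 0" using A3 c1 by (simp add: h_def)
  have q: "0 < q" "q \<le> 1" using A3 by (auto simp: q_def)
  \<comment> \<open>Assumption \<open>less\<close> expanded around a1 = a2 = a3 = 1: all summands on
    the left are nonnegative, and only multiples of \<open>t\<close> are kept afterwards.\<close>
  have "(2 - b) * t + (A - 3) * (1 - b + t) + ((a1-1)*(a2-1) + (a1-1)*(a3-1) + (a2-1)*(a3-1)) + x*y < 2*b"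
    using less unfolding A_def t_def by (simp add: power2_eq_square algebra_simps)
  moreover have "0 \<le> (A - 3) * (1 - b)" "0 \<le> (a1-1)*(a2-1) + (a1-1)*(a3-1) + (a2-1)*(a3-1)" "0 < x*y"
    using A3 b a xy by auto
  ultimately have "(2 - b + (A - 3)) * t < 2 * b" by (simp add: algebra_simps)
  hence "(2 - b + (A - 3)) / (2 * b) < z" using t0 b by (simp add: z_def pos_divide_less_eq pos_less_divide_eq)
  moreover have "(2 - b + (A - 3)) / (2 * b) = z0" using b by (simp add: z0_def h_def c_def field_simps)
  ultimately have "z0 < z" by simp
  \<comment> \<open>Nonnegativity of \<open>z0 + 3 * q - (1 + c)\<close> is what makes the final
    expression monotone in \<open>z\<close> and in \<open>w\<close>.\<close>
  have sigma: "1 + c - 3 * q \<le> z0"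
  proof -
    have "9 / A + (A - 3) / 2 \<ge> 3 / 2"
    proof -
      have "0 \<le> (A - 3)\<^sup>2 + 9" by simp
      thus ?thesis using A3 by (simp add: field_simps power2_eq_square)
    qed
    moreover have "(A - 3) / 2 \<le> h" using c1 A3 mult_right_mono[of 1 c "A - 3"] by (simp add: h_def)
    moreover have "3 * q = 9 / A" by (simp add: q_def)
    ultimately show ?thesis unfolding z0_def by linarith
  qed
  \<comment> \<open>The bounds for \<open>G\<close> and \<open>G2\<close> are their values when each
    of a1, a2, a3 equals the mean \<open>A / 3\<close>, that is \<open>1 / q\<close>; the bound for
    \<open>w\<close> is attained at x = y.\<close>
  have G: "3 * q \<le> G"
  proof -
    have "9 * (a1*a2*a3) \<le> A * (a2*a3 + a1*a3 + a1*a2)"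
    proof -
      have "A * (a2*a3 + a1*a3 + a1*a2) - 9 * (a1*a2*a3) = a1 * (a2-a3)\<^sup>2 + a2 * (a1-a3)\<^sup>2 + a3 * (a1-a2)\<^sup>2"
        by (simp add: A_def power2_eq_square algebra_simps)
      moreover have "0 \<le> \<dots>" using pos by simp
      ultimately show ?thesis by linarith
    qed
    thus ?thesis using pos A3 by (simp add: G_def g1_def g2_def g3_def q_def field_simps)
  qed
  have G2: "3 * q\<^sup>2 \<le> G2"
  proof -
    have "27 * (a1*a2*a3) \<le> A ^ 3" using amgm3[OF pos] by (simp add: A_def)
    hence "27 / A\<^sup>2 \<le> A / (a1*a2*a3)" using pos A3 
      by (simp add: field_simps power2_eq_square power3_eq_cube)
    moreover have "A / (a1*a2*a3) = G2" using pos by (simp add: A_def G2_def g1_def g2_def g3_def field_simps)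
    ultimately show ?thesis by (simp add: q_def power2_eq_square)
  qed
  have w: "4 * z\<^sup>2 \<le> w"
  proof -
    have "4 * (x * y) \<le> t\<^sup>2" using sum_squares_ge_zero[of "x-y" 0] by (simp add: t_def power2_eq_square algebra_simps)
    thus ?thesis using xy t0 by (simp add: z_def w_def field_simps)
  qed
  have T: "1/x + 1/y = w * t" using xy by (simp add: w_def t_def field_simps)
  have zt: "z * t = 1" using t0 by (simp add: z_def)
  have T_ge: "4 * z \<le> 1/x + 1/y"
  proof -
    have "4 * z\<^sup>2 * t \<le> w * t" using w t0 by simp
    moreover have "4 * z\<^sup>2 * t = 4 * z" using zt by (simp add: power2_eq_square)
    ultimately show ?thesis using T by simp
  qed
  have four: "1 + c < 4 * z" using \<open>z0 < z\<close> h0 c1 by (simp add: z0_def)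
  thus ?A using T_ge by (simp add: c_def)

  \<comment> \<open>After replacing \<open>w\<close> by \<open>4 z\<^sup>2\<close>, the quantity to be bounded is increasing in \<open>G\<close>, \<open>G2\<close> and \<open>z\<close>,
    whose lower bounds \<open>3 q\<close>, \<open>3 q\<^sup>2\<close> and \<open>z0\<close> are now inserted one by one (from the bottom up).\<close>
  have "0 \<le> 4*h\<^sup>2 + 4*c*h - 8*h + 13*c - 9*q*c + 3 - 9*q + 3*q\<^sup>2"
  proof -
    \<comment> \<open>The expression equals \<open>(2*h - 1)\<^sup>2 + 4*h*(c - 1) + (1 - q)*(9*c +
      3) + 3*(1 - q)\<^sup>2 + 4*(c - 1)\<close>, a sum of nonnegative terms.\<close>
    have "h * c \<ge> h * 1" using h0 c1 by (intro mult_left_mono) auto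
    moreover have "(2*h - 1)\<^sup>2 \<ge> 0" by simp
    moreover have "(1 - q) * (9 * c + 3) \<ge> 0" using q c1 by simp
    moreover have "(1 - q)\<^sup>2 \<ge> 0" by simp
    ultimately show ?thesis using c1 q by (simp add: power2_eq_square algebra_simps)
  qed
  also have "\<dots> = 4*z0\<^sup>2 + 4*z0*(3*q-(1+c)) - (1+c)*(3*q) + c + 3*q\<^sup>2"
  proof -
    \<comment> \<open>As \<open>A * q = 3\<close>, the mixed product of \<open>q\<close> and
      \<open>h\<close> reduces to terms without \<open>h\<close>.\<close>
    have "q * h = 3/2 * c * (1 - q)" using A3 by (simp add: q_def h_def field_simps)
    hence "h * q = 3/2 * c - 3/2 * (c * q)" by (simp add: algebra_simps)
    thus ?thesis by (simp add: z0_def power2_eq_square algebra_simps)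
  qed
  also have "\<dots> \<le> 4*z\<^sup>2 + 4*z*(3*q-(1+c)) - (1+c)*(3*q) + c + 3*q\<^sup>2"
  proof -
    have "0 \<le> (z - z0) * (4 * (z + (z0 + (3*q-(1+c)))))"
      using \<open>z0 < z\<close> sigma z_pos by (intro mult_nonneg_nonneg) auto
    thus ?thesis by (simp add: power2_eq_square algebra_simps)
  qed
  also have "\<dots> \<le> 4*z\<^sup>2 + 4*z*(G-(1+c)) - (1+c)*G + c + G2"
  proof -
    have "0 \<le> (G - 3*q) * (4*z - (1+c))" using G four by (intro mult_nonneg_nonneg) auto
    thus ?thesis using G2 by (simp add: algebra_simps)
  qed
  also have "\<dots> \<le> G2 + (G - (1+c)) * (w*t) + w - (1+c)*G + c"
  proof -
    \<comment> \<open>The expression is affine in \<open>w\<close> with slope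
      \<open>1 + t * (G - (1+c))\<close>; pulling out \<open>t\<close> by means of
      \<open>z * t = 1\<close> shows that the slope is nonnegative.\<close>
    have "0 \<le> (w - 4*z\<^sup>2) * (t * (z + (G - (1+c))))"
      using w t0 sigma G \<open>z0 < z\<close> by (intro mult_nonneg_nonneg) auto
    also have "\<dots> = (w - 4*z\<^sup>2) * (1 + t * (G - (1+c)))"
      using zt by (simp add: algebra_simps)
    also have "\<dots> = w - 4*z\<^sup>2 + w*t*(G-(1+c)) - 4*z*(z*t)*(G-(1+c))"
      by (simp add: power2_eq_square algebra_simps)
    finally show ?thesis unfolding zt by (simp add: algebra_simps)
  qed
  finally have *: "0 \<le> G2 + (G - (1+c)) * (w*t) + w - (1+c)*G + c" .
  define X where "X = 1 / x"
  define Y where "Y = 1 / y"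
  have XY: "w * t = X + Y" "w = X * Y" using T by (simp_all add: w_def X_def Y_def)
  show ?B using * unfolding XY(1) unfolding XY(2) G_def G2_def 
    unfolding g1_def[symmetric] g2_def[symmetric] g3_def[symmetric] c_def[symmetric] 
      X_def[symmetric] Y_def[symmetric]
    by (simp add: power2_eq_square algebra_simps)
qed

text \<open>All inequalities are homogeneous, so dividing every modulus by \<alpha> reduces to the
  normalised case. The first conclusion makes the signed sum of inverses positive, which allows
  further negative roots to be added later.\<close>

lemma three_large_moduli:
  fixes a1 a2 a3 x y \<alpha> \<beta> :: real
  assumes b: "0 < \<beta>" "\<beta> < \<alpha>" and a: "\<alpha> \<le> a1" "\<alpha> \<le> a2" "\<alpha> \<le> a3" and xy: "0 < x" "0 < y"
    and less: "(a1 + a2 + a3 + x + y - \<alpha> - \<beta>)\<^sup>2 < a1\<^sup>2 + a2\<^sup>2 + a3\<^sup>2 + x\<^sup>2 + y\<^sup>2 + \<alpha>\<^sup>2 + \<beta>\<^sup>2"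
  shows "1/\<alpha> + 1/\<beta> < 1/x + 1/y"
    and "(1/a1)\<^sup>2 + (1/a2)\<^sup>2 + (1/a3)\<^sup>2 + (1/x)\<^sup>2 + (1/y)\<^sup>2 + (1/\<alpha>)\<^sup>2 + (1/\<beta>)\<^sup>2
      \<le> (1/a1 + 1/a2 + 1/a3 + 1/x + 1/y - 1/\<alpha> - 1/\<beta>)\<^sup>2"
proof -
  have \<alpha>: "\<alpha> > 0" using b by simp
  define s where "s = 1 / \<alpha>"
  have s: "s > 0" "s * \<alpha> = 1" using \<alpha> by (auto simp: s_def)
  have ge: "1 \<le> s * r" if "\<alpha> \<le> r" for r using that \<alpha> by (simp add: s_def)
  have "s\<^sup>2 * (a1 + a2 + a3 + x + y - \<alpha> - \<beta>)\<^sup>2 < s\<^sup>2 * (a1\<^sup>2 + a2\<^sup>2 + a3\<^sup>2 + x\<^sup>2 + y\<^sup>2 + \<alpha>\<^sup>2 + \<beta>\<^sup>2)"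
    using less s by simp
  also have "s\<^sup>2 * (a1 + a2 + a3 + x + y - \<alpha> - \<beta>)\<^sup>2 = (s*a1 + s*a2 + s*a3 + s*x + s*y - s*\<alpha> - s*\<beta>)\<^sup>2"
    by (simp add: power_mult_distrib[symmetric] algebra_simps)
  also have "s\<^sup>2 * (a1\<^sup>2 + a2\<^sup>2 + a3\<^sup>2 + x\<^sup>2 + y\<^sup>2 + \<alpha>\<^sup>2 + \<beta>\<^sup>2) = 
      (s*a1)\<^sup>2 + (s*a2)\<^sup>2 + (s*a3)\<^sup>2 + (s*x)\<^sup>2 + (s*y)\<^sup>2 + (s*\<alpha>)\<^sup>2 + (s*\<beta>)\<^sup>2"
    by (simp add: power_mult_distrib algebra_simps)
  finally have less': "(s*a1 + s*a2 + s*a3 + s*x + s*y - 1 - s*\<beta>)\<^sup>2 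
      < (s*a1)\<^sup>2 + (s*a2)\<^sup>2 + (s*a3)\<^sup>2 + (s*x)\<^sup>2 + (s*y)\<^sup>2 + 1 + (s*\<beta>)\<^sup>2" by (simp add: s)
  have "0 < s * \<beta>" "s * \<beta> < 1" using b \<alpha> by (auto simp: s_def)
  moreover have "0 < s * x" "0 < s * y" using s xy by auto
  ultimately have 1: "1 + 1/(s*\<beta>) < 1/(s*x) + 1/(s*y)"
    and 2: "(1/(s*a1))\<^sup>2 + (1/(s*a2))\<^sup>2 + (1/(s*a3))\<^sup>2 + (1/(s*x))\<^sup>2 + (1/(s*y))\<^sup>2 + 1 + (1/(s*\<beta>))\<^sup>2
      \<le> (1/(s*a1) + 1/(s*a2) + 1/(s*a3) + 1/(s*x) + 1/(s*y) - 1 - 1/(s*\<beta>))\<^sup>2"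
    using three_large_moduli_normalised[OF _ _ ge[OF a(1)] ge[OF a(2)] ge[OF a(3)] _ _ less'] by auto
  have inv: "1 / r = s * (1 / (s * r))" for r using s by simp
  have one: "1 / \<alpha> = s * 1" by (simp add: s_def)
  have "s * (1 + 1/(s*\<beta>)) < s * (1/(s*x) + 1/(s*y))" using 1 s by simp
  thus "1/\<alpha> + 1/\<beta> < 1/x + 1/y" unfolding one using s by (simp add: algebra_simps)
  have "s\<^sup>2 * ((1/(s*a1))\<^sup>2 + (1/(s*a2))\<^sup>2 + (1/(s*a3))\<^sup>2 + (1/(s*x))\<^sup>2 + (1/(s*y))\<^sup>2 + 1 + (1/(s*\<beta>))\<^sup>2)
      \<le> s\<^sup>2 * (1/(s*a1) + 1/(s*a2) + 1/(s*a3) + 1/(s*x) + 1/(s*y) - 1 - 1/(s*\<beta>))\<^sup>2"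
    using 2 s by simp
  also have "\<dots> = (s * (1/(s*a1)) + s * (1/(s*a2)) + s * (1/(s*a3)) + s * (1/(s*x)) + s * (1/(s*y)) - s - s * (1/(s*\<beta>)))\<^sup>2"
    by (simp only: power_mult_distrib[symmetric] ring_distribs mult_1_right)
  finally show "(1/a1)\<^sup>2 + (1/a2)\<^sup>2 + (1/a3)\<^sup>2 + (1/x)\<^sup>2 + (1/y)\<^sup>2 + (1/\<alpha>)\<^sup>2 + (1/\<beta>)\<^sup>2
      \<le> (1/a1 + 1/a2 + 1/a3 + 1/x + 1/y - 1/\<alpha> - 1/\<beta>)\<^sup>2"
    unfolding inv[symmetric] ring_distribs power_mult_distrib[symmetric] mult_1_right
    by (simp add: s_def)
qed

subsection \<open>Polynomials with simple real roots\<close>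

lemma map_poly_of_real_mult:
  "map_poly of_real (p * q) = (map_poly of_real p * map_poly of_real q :: complex poly)"
  by (intro poly_eqI) (simp add: coeff_map_poly coeff_mult)

lemma map_poly_of_real_prod:
  "map_poly of_real (\<Prod>i\<in>I. f i) = (\<Prod>i\<in>I. map_poly of_real (f i) :: complex poly)"
  by (induction I rule: infinite_finite_induct) (simp_all add: map_poly_of_real_mult)

lemma map_poly_of_real_eq_iff:
  "(map_poly of_real p = (map_poly of_real q :: complex poly)) \<longleftrightarrow> p = q"
  by (simp add: poly_eq_iff coeff_map_poly)

lemma poly_map_poly_of_real:
  "poly (map_poly of_real p) (of_real x :: complex) = of_real (poly p x)"
  by (induction p) (simp_all add: map_poly_pCons)

lemma pderiv_map_poly_of_real:
  "pderiv (map_poly of_real p :: complex poly) = map_poly of_real (pderiv p)"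
  by (intro poly_eqI) (simp add: coeff_map_poly coeff_pderiv)

text \<open>The factorization is taken over the complex numbers and pulled back. Simplicity of the
  roots carries over because a common complex root of \<open>Q\<close> and its derivative is real by
  hyperbolicity.\<close>

lemma hyperbolic_rsquarefree_decompose:
  assumes "hyperbolic Q" "rsquarefree Q"
  shows "Q = smult (lead_coeff Q) (\<Prod>r | poly Q r = 0. [:-r, 1:])"
proof -
  let ?c = "map_poly of_real :: real poly \<Rightarrow> complex poly"
  have real: "z \<in> \<real>" if "poly (?c Q) z = 0" for z
    using assms(1) that by (auto simp: hyperbolic_def)
  have "rsquarefree (?c Q)"
    unfolding rsquarefree_roots pderiv_map_poly_of_real
  proof safe
    fix z assume z: "poly (?c Q) z = 0" "poly (?c (pderiv Q)) z = 0"
    with real obtain x where "z = of_real x" by (meson Reals_cases)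
    with z assms(2) show False by (auto simp: poly_map_poly_of_real rsquarefree_roots)
  qed
  hence "?c Q = smult (lead_coeff (?c Q)) (\<Prod>z | poly (?c Q) z = 0. [:-z, 1:])"
    by (rule complex_poly_decompose_rsquarefree[symmetric])
  also have "{z. poly (?c Q) z = 0} = of_real ` {x. poly Q x = 0}"
    by (auto simp: poly_map_poly_of_real image_iff) (metis real Reals_cases poly_map_poly_of_real of_real_eq_0_iff)
  also have "lead_coeff (?c Q) = of_real (lead_coeff Q)"
    by (simp add: coeff_map_poly degree_map_poly)
  also have "(\<Prod>z\<in>of_real ` {x. poly Q x = 0}. [:-z, 1:]) = (\<Prod>x | poly Q x = 0. ?c [:-x, 1:])"
    by (subst prod.reindex) (auto simp: inj_on_def map_poly_pCons)
  also have "smult (of_real (lead_coeff Q)) \<dots> = ?c (smult (lead_coeff Q) (\<Prod>x | poly Q x = 0. [:-x, 1:]))"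
    by (simp add: map_poly_of_real_prod map_poly_smult)
  finally show ?thesis unfolding map_poly_of_real_eq_iff .
qed

section \<open>Monic polynomials with prescribed simple roots\<close>

definition root_poly :: "real set \<Rightarrow> real poly" where
  "root_poly R = (\<Prod>r\<in>R. [:-r, 1:])"

lemma root_poly_insert:
  "finite R \<Longrightarrow> r \<notin> R \<Longrightarrow> root_poly (insert r R) = [:-r, 1:] * root_poly R"
  by (simp add: root_poly_def)

lemma poly_root_poly_eq_0_iff: "finite R \<Longrightarrow> poly (root_poly R) x = 0 \<longleftrightarrow> x \<in> R"
  by (auto simp: root_poly_def poly_prod)

lemma degree_root_poly: "degree (root_poly R) = card R"
  unfolding root_poly_def by (subst degree_prod_eq_sum_degree) auto

lemma lead_coeff_root_poly: "coeff (root_poly R) (card R) = 1"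
proof -
  have "lead_coeff (root_poly R) = 1" by (simp add: root_poly_def lead_coeff_prod)
  thus ?thesis by (simp add: degree_root_poly)
qed

lemma root_poly_nonzero: "root_poly R \<noteq> 0"
  using lead_coeff_root_poly[of R] by auto

lemma hyperbolic_root_poly:
  assumes "finite R" shows "hyperbolic (root_poly R)"
  unfolding hyperbolic_def root_poly_def map_poly_of_real_prod poly_prod
  using assms by (auto simp: map_poly_pCons add_eq_0_iff)

lemma rsquarefree_root_poly:
  assumes "finite R" shows "rsquarefree (root_poly R)"
  using assms
proof (induction R rule: finite_induct)
  case (insert r R)
  have "order a (root_poly (insert r R)) = order a [:-r, 1:] + order a (root_poly R)" for a
    unfolding root_poly_insert[OF insert(1,2)]
    by (intro order_mult no_zero_divisors) (simp_all add: root_poly_nonzero)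
  moreover have "order a [:-r, 1:] = (if a = r then 1 else 0)" for a
    using order_power_n_n[of r 1] by (auto intro!: order_0I)
  moreover have "order r (root_poly R) = 0"
    using insert by (intro order_0I) (simp add: poly_root_poly_eq_0_iff)
  ultimately show ?case using insert
    by (auto simp: rsquarefree_def root_poly_nonzero)
qed (simp add: root_poly_def rsquarefree_def)

text \<open>The first two elementary symmetric functions up to sign, the second one expressed by
  power sums. Both ends of \<open>root_poly\<close> are reduced to this product.\<close>

lemma coeff_prod_one_minus:
  fixes f :: "'a \<Rightarrow> real"
  assumes "finite I"
  defines "p \<equiv> (\<Prod>i\<in>I. [:1, - f i:])"
  shows "coeff p 0 = 1" "coeff p 1 = - (\<Sum>i\<in>I. f i)"
    "2 * coeff p 2 = (\<Sum>i\<in>I. f i)\<^sup>2 - (\<Sum>i\<in>I. (f i)\<^sup>2)"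
proof -
  have "coeff p 0 = 1 \<and> coeff p 1 = - (\<Sum>i\<in>I. f i) \<and>
    2 * coeff p 2 = (\<Sum>i\<in>I. f i)\<^sup>2 - (\<Sum>i\<in>I. (f i)\<^sup>2)"
    using assms(1) unfolding p_def
    by (induction I rule: finite_induct)
      (auto simp: coeff_pCons numeral_2_eq_2 power2_eq_square algebra_simps split: nat.splits)
  thus "coeff p 0 = 1" "coeff p 1 = - (\<Sum>i\<in>I. f i)"
    "2 * coeff p 2 = (\<Sum>i\<in>I. f i)\<^sup>2 - (\<Sum>i\<in>I. (f i)\<^sup>2)" by auto
qed

text \<open>Reversing the coefficients turns each factor x - r into 1 - r x, so the top coefficients
  become the bottom ones of such a product.\<close>

lemma root_poly_top_coeffs:
  assumes "finite R" 
  shows "card R \<ge> 1 \<Longrightarrow> coeff (root_poly R) (card R - 1) = - \<Sum>R"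
    and "card R \<ge> 2 \<Longrightarrow> 2 * coeff (root_poly R) (card R - 2) = (\<Sum>R)\<^sup>2 - (\<Sum>r\<in>R. r\<^sup>2)"
proof -
  have refl: "reflect_poly [:-r, 1:] = [:1, -r:]" for r :: real
    by (cases "r = 0") (simp_all add: reflect_poly_def)
  have "reflect_poly (root_poly R) = (\<Prod>r\<in>R. [:1, -r:])"
    unfolding root_poly_def reflect_poly_prod refl ..
  hence "coeff (root_poly R) (card R - k) = coeff (\<Prod>r\<in>R. [:1, -r:]) k" if "k \<le> card R" for k
    using coeff_reflect_poly[of "root_poly R" k] that by (simp add: degree_root_poly)
  thus "card R \<ge> 1 \<Longrightarrow> coeff (root_poly R) (card R - 1) = - \<Sum>R"
    "card R \<ge> 2 \<Longrightarrow> 2 * coeff (root_poly R) (card R - 2) = (\<Sum>R)\<^sup>2 - (\<Sum>r\<in>R. r\<^sup>2)"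
    using coeff_prod_one_minus[OF assms, of "\<lambda>r. r"] by auto
qed

text \<open>Extracting -r from each factor leaves 1 - x/r, so the inverses of the roots take the
  place of the roots.\<close>

lemma root_poly_low_coeffs:
  assumes "finite R" "0 \<notin> R"
  shows "coeff (root_poly R) 0 = (\<Prod>r\<in>R. - r)"
    and "coeff (root_poly R) 1 = (\<Prod>r\<in>R. - r) * (- (\<Sum>r\<in>R. 1/r))"
    and "2 * coeff (root_poly R) 2 = (\<Prod>r\<in>R. - r) * ((\<Sum>r\<in>R. 1/r)\<^sup>2 - (\<Sum>r\<in>R. (1/r)\<^sup>2))"
proof -
  have "root_poly R = (\<Prod>r\<in>R. smult (-r) [:1, -(1/r):])"
    unfolding root_poly_def using assms by (intro prod.cong) auto
  also have "\<dots> = smult (\<Prod>r\<in>R. - r) (\<Prod>r\<in>R. [:1, -(1/r):])"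
    by (rule prod_smult)
  finally have *: "root_poly R = \<dots>" .
  show "coeff (root_poly R) 0 = (\<Prod>r\<in>R. - r)"
    "coeff (root_poly R) 1 = (\<Prod>r\<in>R. - r) * (- (\<Sum>r\<in>R. 1/r))"
    "2 * coeff (root_poly R) 2 = (\<Prod>r\<in>R. - r) * ((\<Sum>r\<in>R. 1/r)\<^sup>2 - (\<Sum>r\<in>R. (1/r)\<^sup>2))"
    unfolding * coeff_smult mult.left_commute[of 2]
    by (simp_all only: coeff_prod_one_minus[OF assms(1), of "\<lambda>r. 1/r"] mult_1_right)
qed

text \<open>The pattern lists coefficients from the leading one down, but the block {2..n+1} is
  invariant under k -> n + 3 - k, so the same index range serves for coefficients counted from the
  constant term.\<close>

lemma sign_pattern_Sigma_iff:
  assumes "n \<ge> 1"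
  shows "sign_pattern Q = Sigma_pattern 2 n 2 \<longleftrightarrow> degree Q = n + 3 \<and>
    (\<forall>k \<le> n + 3. if k \<in> {2..n+1} then coeff Q k < 0 else coeff Q k > 0)"
proof (cases "Q = 0")
  case True
  thus ?thesis by (auto simp: sign_pattern_def Sigma_pattern_def)
next
  case False
  have nth: "sign_pattern Q ! i = sgn (coeff Q (degree Q - i))" if "i \<le> degree Q" for i
    using that False by (simp add: sign_pattern_def rev_nth length_coeffs_degree coeffs_nth)
  have nth': "Sigma_pattern 2 n 2 ! i = (if i \<in> {2..n+1} then -1 else 1)" if "i \<le> n + 3" for i
    using that by (auto simp: Sigma_pattern_def nth_append numeral_2_eq_2 nth_Cons split: nat.splits)
  have len: "length (sign_pattern Q) = degree Q + 1" "length (Sigma_pattern 2 n 2) = n + 4"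
    using False by (auto simp: sign_pattern_def Sigma_pattern_def length_coeffs)
  have "sign_pattern Q = Sigma_pattern 2 n 2 \<longleftrightarrow> degree Q = n + 3 \<and>
      (\<forall>i \<le> n + 3. sgn (coeff Q (n + 3 - i)) = (if i \<in> {2..n+1} then -1 else 1))"
  proof (cases "degree Q = n + 3")
    case True
    thus ?thesis unfolding list_eq_iff_nth_eq len using nth nth' by (auto simp: less_Suc_eq_le simp del: atLeastAtMost_iff)
  next
    case False
    hence "length (sign_pattern Q) \<noteq> length (Sigma_pattern 2 n 2)" unfolding len by simp
    thus ?thesis using False by auto
  qed
  also have "(\<forall>i \<le> n + 3. sgn (coeff Q (n + 3 - i)) = (if i \<in> {2..n+1} then -1 else 1))
      \<longleftrightarrow> (\<forall>k \<le> n + 3. sgn (coeff Q k) = (if k \<in> {2..n+1} then -1 else 1))"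
  proof safe
    fix k assume *: "\<forall>i \<le> n + 3. sgn (coeff Q (n + 3 - i)) = (if i \<in> {2..n+1} then -1 else 1)" 
      and "k \<le> n + 3"
    thus "sgn (coeff Q k) = (if k \<in> {2..n+1} then -1 else 1)" 
      using *[rule_format, of "n + 3 - k"] by (auto split: if_splits)
  next
    fix k assume *: "\<forall>i \<le> n + 3. sgn (coeff Q i) = (if i \<in> {2..n+1} then -1 else 1)" 
      and "k \<le> n + 3"
    thus "sgn (coeff Q (n + 3 - k)) = (if k \<in> {2..n+1} then -1 else 1)" 
      using *[rule_format, of "n + 3 - k"] by (auto split: if_splits)
  qed
  also have "\<dots> \<longleftrightarrow> (\<forall>k \<le> n + 3. if k \<in> {2..n+1} then coeff Q k < 0 else coeff Q k > 0)"
    by (auto simp: sgn_1_pos sgn_1_neg)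
  finally show ?thesis .
qed

subsection \<open>Non-realizable couples\<close>

lemma sum_squares_le_square_sum:
  fixes f :: "'a \<Rightarrow> real"
  assumes "\<And>i. i \<in> I \<Longrightarrow> 0 \<le> f i"
  shows "(\<Sum>i\<in>I. (f i)\<^sup>2) \<le> (\<Sum>i\<in>I. f i)\<^sup>2"
  using assms
proof (induction I rule: infinite_finite_induct)
  case (insert i I)
  have "0 \<le> f i * (\<Sum>i\<in>I. f i)" using insert by (intro mult_nonneg_nonneg sum_nonneg) auto
  thus ?case using insert by (simp add: power2_eq_square algebra_simps)
qed auto

text \<open>Five moduli suffice for the contradiction: three in \<open>J\<close> and any two others,
  which exist as \<open>card I \<ge> 5\<close>. The remaining ones, \<open>D\<close>, can be
  discarded from the assumption and restored in the conclusion because the signed sums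
  \<open>S\<close> and \<open>T\<close> over the core are nonnegative, so cross terms with
  \<open>D\<close> only help.\<close>

lemma sum_inverse_sum_inverse_squares_bound:
  fixes g :: "'i \<Rightarrow> real"
  assumes I: "finite I" "card I \<ge> 5" and g: "\<And>i. i \<in> I \<Longrightarrow> 0 < g i"
    and J: "J \<subseteq> I" "card J = 3" "\<And>i. i \<in> J \<Longrightarrow> \<alpha> \<le> g i" and \<beta>: "0 < \<beta>" "\<beta> < \<alpha>"
    and less: "((\<Sum>i\<in>I. g i) - \<alpha> - \<beta>)\<^sup>2 < (\<Sum>i\<in>I. (g i)\<^sup>2) + \<alpha>\<^sup>2 + \<beta>\<^sup>2"
  shows "(\<Sum>i\<in>I. (1 / g i)\<^sup>2) + (1/\<alpha>)\<^sup>2 + (1/\<beta>)\<^sup>2 \<le> ((\<Sum>i\<in>I. 1 / g i) - 1/\<alpha> - 1/\<beta>)\<^sup>2"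
proof -
  have fJ: "finite J" using I J by (meson finite_subset)
  have "card (I - J) \<ge> 2" using I J fJ by (simp add: card_Diff_subset)
  then obtain K where K: "K \<subseteq> I - J" "card K = 2" by (meson obtain_subset_with_card_n)
  from J(2) obtain i1 i2 i3 where i: "J = {i1, i2, i3}" "i1 \<noteq> i2" "i1 \<noteq> i3" "i2 \<noteq> i3"
    by (auto simp: card_3_iff)
  from K(2) obtain j k where jk: "K = {j, k}" "j \<noteq> k" by (auto simp: card_2_iff)
  define D where "D = I - (J \<union> K)"
  have split: "(\<Sum>i\<in>I. f i) = f i1 + f i2 + f i3 + f j + f k + (\<Sum>i\<in>D. f i)" for f :: "'i \<Rightarrow> real"
  proof -
    have JK: "J \<inter> K = {}" "finite K" "finite D" "(J \<union> K) \<inter> D = {}"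
      using I K by (auto simp: D_def jk(1))
    have "I = (J \<union> K) \<union> D" using J(1) K(1) by (auto simp: D_def)
    hence "(\<Sum>i\<in>I. f i) = (\<Sum>i\<in>J. f i) + (\<Sum>i\<in>K. f i) + (\<Sum>i\<in>D. f i)"
      using fJ JK by (simp add: sum.union_disjoint)
    thus ?thesis unfolding i(1) jk(1) using i(2-) jk(2) by simp
  qed
  have D_nonneg: "0 \<le> g i" if "i \<in> D" for i using g[of i] that by (auto simp: D_def)
  define S where "S = g i1 + g i2 + g i3 + g j + g k - \<alpha> - \<beta>"
  define T where "T = 1 / g i1 + 1 / g i2 + 1 / g i3 + 1 / g j + 1 / g k - 1/\<alpha> - 1/\<beta>"
  have jk_pos: "0 < g j" "0 < g k" using g jk K by auto
  have \<alpha>: "\<alpha> \<le> g i1" "\<alpha> \<le> g i2" "\<alpha> \<le> g i3" using J i by auto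
  have S: "0 \<le> S" using \<alpha> jk_pos \<beta> by (simp add: S_def)
  define d where "d = (\<Sum>i\<in>D. g i)"
  define e where "e = (\<Sum>i\<in>D. 1 / g i)"
  have d: "0 \<le> d" "(\<Sum>i\<in>D. (g i)\<^sup>2) \<le> d\<^sup>2"
    unfolding d_def using D_nonneg by (auto intro: sum_nonneg sum_squares_le_square_sum)
  have e: "0 \<le> e" "(\<Sum>i\<in>D. (1 / g i)\<^sup>2) \<le> e\<^sup>2"
    unfolding e_def using D_nonneg by (intro sum_nonneg sum_squares_le_square_sum; simp)+
  have "(S + d)\<^sup>2 < (g i1)\<^sup>2 + (g i2)\<^sup>2 + (g i3)\<^sup>2 + (g j)\<^sup>2 + (g k)\<^sup>2 + \<alpha>\<^sup>2 + \<beta>\<^sup>2 + (\<Sum>i\<in>D. (g i)\<^sup>2)"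
    using less unfolding split S_def d_def by (simp add: algebra_simps)
  moreover have "S\<^sup>2 + d\<^sup>2 \<le> (S + d)\<^sup>2" using S d by (simp add: power2_sum)
  ultimately have "S\<^sup>2 < (g i1)\<^sup>2 + (g i2)\<^sup>2 + (g i3)\<^sup>2 + (g j)\<^sup>2 + (g k)\<^sup>2 + \<alpha>\<^sup>2 + \<beta>\<^sup>2"
    using d(2) by linarith
  note core = three_large_moduli[OF \<beta> \<alpha> jk_pos this[unfolded S_def], folded T_def]
  have inv_pos: "0 < 1 / g i1" "0 < 1 / g i2" "0 < 1 / g i3" using \<alpha> \<beta> by auto
  have "0 \<le> T" unfolding T_def using core(1) inv_pos by linarith
  hence "T\<^sup>2 + e\<^sup>2 \<le> (T + e)\<^sup>2" using e by (simp add: power2_sum)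
  hence "(1/g i1)\<^sup>2 + (1/g i2)\<^sup>2 + (1/g i3)\<^sup>2 + (1/g j)\<^sup>2 + (1/g k)\<^sup>2 + (1/\<alpha>)\<^sup>2 + (1/\<beta>)\<^sup>2 
      + (\<Sum>i\<in>D. (1 / g i)\<^sup>2) \<le> (T + e)\<^sup>2" using core(2) e(2) by linarith
  moreover have "(\<Sum>i\<in>I. 1 / g i) - 1/\<alpha> - 1/\<beta> = T + e" unfolding split T_def e_def by simp
  ultimately show ?thesis unfolding split[of "\<lambda>i. (1 / g i)\<^sup>2"] by simp
qed

text \<open>The two inequalities are the signs of the coefficients at n + 1 and 2; at the low end
  the positive constant term shows that the product factored out is positive.\<close>

lemma Sigma_pattern_sum_bounds:
  assumes Q: "hyperbolic Q" "rsquarefree Q" "sign_pattern Q = Sigma_pattern 2 n 2" and n: "n \<ge> 2"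
  defines "R \<equiv> {x. poly Q x = 0}"
  shows "finite R" "0 \<notin> R" "(\<Sum>r\<in>R. r)\<^sup>2 < (\<Sum>r\<in>R. r\<^sup>2)" "(\<Sum>r\<in>R. 1/r)\<^sup>2 < (\<Sum>r\<in>R. (1/r)\<^sup>2)"
proof -
  define c where "c = lead_coeff Q"
  have pattern: "degree Q = n + 3" "\<And>k. k \<le> n + 3 \<Longrightarrow> if k \<in> {2..n+1} then coeff Q k < 0 else coeff Q k > 0"
    using Q(3) n by (auto simp: sign_pattern_Sigma_iff)
  have c: "c > 0" using pattern(1) pattern(2)[of "n+3"] by (simp add: c_def)
  have "Q \<noteq> 0" using pattern(1) by auto
  thus fin: "finite R" unfolding R_def by (rule poly_roots_finite)
  have Q_eq: "Q = smult c (root_poly R)"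
    using hyperbolic_rsquarefree_decompose[OF Q(1,2)] by (simp add: root_poly_def c_def R_def)
  have card: "card R = n + 3" using pattern(1) c arg_cong[OF Q_eq, of degree]
    by (simp add: degree_root_poly)
  have coeffs: "coeff (root_poly R) 0 > 0" "coeff (root_poly R) 2 < 0" "coeff (root_poly R) (n+1) < 0"
    using pattern(2)[of 0] pattern(2)[of 2] pattern(2)[of "n+1"] c n unfolding Q_eq
    by (simp_all add: zero_less_mult_iff mult_less_0_iff)
  have "poly Q 0 \<noteq> 0" using pattern(2)[of 0] by (simp add: poly_0_coeff_0)
  thus R0: "0 \<notin> R" by (simp add: R_def)
  show "(\<Sum>r\<in>R. r)\<^sup>2 < (\<Sum>r\<in>R. r\<^sup>2)"
    using root_poly_top_coeffs(2)[OF fin] card coeffs(3) by simp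
  have "(\<Prod>r\<in>R. - r) > 0" using coeffs(1) root_poly_low_coeffs(1)[OF fin R0] by simp
  moreover have "(\<Prod>r\<in>R. - r) * ((\<Sum>r\<in>R. 1/r)\<^sup>2 - (\<Sum>r\<in>R. (1/r)\<^sup>2)) < 0"
    using root_poly_low_coeffs(3)[OF fin R0] coeffs(2) by linarith
  ultimately show "(\<Sum>r\<in>R. 1/r)\<^sup>2 < (\<Sum>r\<in>R. (1/r)\<^sup>2)" by (simp add: mult_less_0_iff)
qed

text \<open>Replaces the polynomial and the extended reals by real moduli \<open>g i\<close> with
  power-sum inequalities, the only form used for the contradiction.\<close>

lemma realizable_Sigma_2_2E:
  assumes "realizable (Sigma_pattern 2 n 2) (u, v, w)" "n \<ge> 2"
  obtains \<alpha> \<beta> :: real and g :: "nat \<Rightarrow> real" where "u + v + w = n + 1" "0 < \<beta>" "\<beta> < \<alpha>"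
    "\<And>i. i \<in> {1..n+1} \<Longrightarrow> 0 < g i" 
    "\<And>i. i \<in> {1..n+1} \<Longrightarrow> i \<le> u \<Longrightarrow> g i < \<beta>" 
    "\<And>i. i \<in> {1..n+1} \<Longrightarrow> u + v < i \<Longrightarrow> \<alpha> < g i" 
    "((\<Sum>i=1..n+1. g i) - \<alpha> - \<beta>)\<^sup>2 < (\<Sum>i=1..n+1. (g i)\<^sup>2) + \<alpha>\<^sup>2 + \<beta>\<^sup>2"
    "((\<Sum>i=1..n+1. 1 / g i) - 1/\<alpha> - 1/\<beta>)\<^sup>2 < (\<Sum>i=1..n+1. (1 / g i)\<^sup>2) + (1/\<alpha>)\<^sup>2 + (1/\<beta>)\<^sup>2"
proof -
  let ?I = "{1..n+1}"
  have d: "length (Sigma_pattern 2 n 2) - 1 = n + 3" "n + 3 - 2 = n + 1" "n + 3 - 1 = n + 2" 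
    by (auto simp: Sigma_pattern_def)
  from assms(1)[unfolded realizable_def Let_def prod.case d] obtain Q \<alpha> \<beta> \<gamma> where
    uvw: "u + v + w = n + 1" and
    Q: "hyperbolic Q" "sign_pattern Q = Sigma_pattern 2 n 2" "distinct_moduli Q" and
    pos: "{x. poly Q x = 0 \<and> x > 0} = {\<beta>, \<alpha>}" and less: "\<beta> < \<alpha>" and
    im: "\<gamma> ` ?I = (\<lambda>x. ereal \<bar>x\<bar>) ` {x. poly Q x = 0 \<and> x < 0}" and
    mono: "strict_mono_on ?I \<gamma>" and
    \<gamma>: "\<gamma> u < ereal \<beta>" "ereal \<alpha> < \<gamma> (u + v + 1)"
    by blast
  define R where "R = {x. poly Q x = 0}"
  note bounds = Sigma_pattern_sum_bounds[OF Q(1) _ Q(2) assms(2), folded R_def]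
  have R: "finite R" "0 \<notin> R" "(\<Sum>r\<in>R. r)\<^sup>2 < (\<Sum>r\<in>R. r\<^sup>2)" "(\<Sum>r\<in>R. 1/r)\<^sup>2 < (\<Sum>r\<in>R. (1/r)\<^sup>2)"
    using bounds Q(3) by (auto simp: distinct_moduli_def)
  define N where "N = {x\<in>R. x < 0}"
  \<comment> \<open>\<open>real_of_ereal\<close> loses nothing on {1..n+1}, where each value of
    \<gamma> is the modulus of a root and hence finite.\<close>
  define g where "g = real_of_ereal \<circ> \<gamma>"
  have im': "\<gamma> ` ?I = (\<lambda>x. ereal \<bar>x\<bar>) ` N" using im by (simp add: N_def R_def)
  have g_eq: "\<gamma> i = ereal (g i)" if "i \<in> ?I" for i
  proof -
    have "\<gamma> i \<in> (\<lambda>x. ereal \<bar>x\<bar>) ` N" using that im' by blast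
    thus ?thesis by (auto simp: g_def)
  qed
  have N: "N = (\<lambda>i. - g i) ` ?I"
  proof -
    have "g ` ?I = real_of_ereal ` (\<gamma> ` ?I)" by (simp add: g_def image_comp)
    also have "\<dots> = (\<lambda>x. - x) ` N" unfolding im' image_image 
      by (intro image_cong) (auto simp: N_def)
    finally have "uminus ` g ` ?I = uminus ` uminus ` N" by simp
    thus ?thesis by (simp add: image_image)
  qed
  have g_mono: "g i < g j" if "i \<in> ?I" "j \<in> ?I" "i < j" for i j
    using strict_mono_onD[OF mono that] g_eq that by simp
  have inj: "inj_on (\<lambda>i. - g i) ?I"
    by (rule inj_onI) (metis g_mono linorder_neqE_nat less_irrefl neg_equal_iff_equal)
  have pos': "{x\<in>R. x > 0} = {\<beta>, \<alpha>}" using pos by (simp add: R_def)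
  have R_eq: "R = insert \<alpha> (insert \<beta> N)" 
  proof -
    have "R = {x\<in>R. x > 0} \<union> N" 
      using R(2) by (auto simp: N_def) (metis linorder_neqE)
    thus ?thesis unfolding pos' by auto
  qed
  have \<beta>: "0 < \<beta>" using pos' by blast
  have notin: "\<alpha> \<notin> N" "\<beta> \<notin> N" using \<beta> less by (auto simp: N_def)
  have fin: "finite N" using R(1) by (simp add: N_def)
  have sum: "(\<Sum>r\<in>R. f r) = f \<alpha> + f \<beta> + (\<Sum>i\<in>?I. f (- g i))" for f :: "real \<Rightarrow> real"
  proof -
    have "(\<Sum>r\<in>R. f r) = f \<alpha> + f \<beta> + (\<Sum>r\<in>N. f r)"
      unfolding R_eq using fin notin less by simp
    thus ?thesis unfolding N using inj by (simp add: sum.reindex)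
  qed
  show thesis
  proof (rule that[OF uvw \<beta> less])
    fix i assume i: "i \<in> ?I"
    have "- g i \<in> N" using i N by blast
    thus "0 < g i" by (simp add: N_def)
    show "g i < \<beta>" if "i \<le> u"
    proof -
      have "u \<in> ?I" using that i uvw by auto
      moreover have "g i \<le> g u" using g_mono[OF i \<open>u \<in> ?I\<close>] that by (cases "i = u") auto
      ultimately show ?thesis using \<gamma>(1) g_eq[of u] by simp
    qed
    show "\<alpha> < g i" if "u + v < i"
    proof -
      have *: "u + v + 1 \<in> ?I" using that i by auto
      moreover have "g (u + v + 1) \<le> g i" using g_mono[OF * i] that by (cases "i = u + v + 1") auto
      ultimately show ?thesis using \<gamma>(2) g_eq[OF *] by simp
    qed
  next
    \<comment> \<open>The negative roots are \<open>- g i\<close>, so the two sums differ by an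
      overall sign, which the square removes.\<close>
    have "((\<Sum>i\<in>?I. g i) - \<alpha> - \<beta>)\<^sup>2 = (\<Sum>r\<in>R. r)\<^sup>2"
      unfolding sum by (simp add: sum_negf power2_eq_square algebra_simps)
    also note R(3)
    finally show "((\<Sum>i\<in>?I. g i) - \<alpha> - \<beta>)\<^sup>2 < (\<Sum>i\<in>?I. (g i)\<^sup>2) + \<alpha>\<^sup>2 + \<beta>\<^sup>2"
      unfolding sum by simp
    have "((\<Sum>i\<in>?I. 1 / g i) - 1/\<alpha> - 1/\<beta>)\<^sup>2 = (\<Sum>r\<in>R. 1/r)\<^sup>2"
      unfolding sum by (simp add: sum_negf power2_eq_square algebra_simps)
    also note R(4)
    finally show "((\<Sum>i\<in>?I. 1 / g i) - 1/\<alpha> - 1/\<beta>)\<^sup>2 < (\<Sum>i\<in>?I. (1 / g i)\<^sup>2) + (1/\<alpha>)\<^sup>2 + (1/\<beta>)\<^sup>2"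
      unfolding sum by simp
  qed
qed

text \<open>Here n \<ge> 4 guarantees five negative roots. For w \<ge> 3 the last three indices lie
  beyond u + v and serve as \<open>J\<close>; for u \<ge> 3 the first three do so after
  inversion.\<close>

lemma not_realizable_Sigma_2_2:
  assumes "n \<ge> 4" "u \<ge> 3 \<or> w \<ge> 3"
  shows "\<not> realizable (Sigma_pattern 2 n 2) (u, v, w)"
proof
  assume "realizable (Sigma_pattern 2 n 2) (u, v, w)"
  then obtain \<alpha> \<beta> and g :: "nat \<Rightarrow> real" where uvw: "u + v + w = n + 1" and \<beta>: "0 < \<beta>" "\<beta> < \<alpha>"
    and pos: "\<And>i. i \<in> {1..n+1} \<Longrightarrow> 0 < g i" 
    and small: "\<And>i. i \<in> {1..n+1} \<Longrightarrow> i \<le> u \<Longrightarrow> g i < \<beta>" 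
    and large: "\<And>i. i \<in> {1..n+1} \<Longrightarrow> u + v < i \<Longrightarrow> \<alpha> < g i" 
    and less: "((\<Sum>i=1..n+1. g i) - \<alpha> - \<beta>)\<^sup>2 < (\<Sum>i=1..n+1. (g i)\<^sup>2) + \<alpha>\<^sup>2 + \<beta>\<^sup>2"
      "((\<Sum>i=1..n+1. 1 / g i) - 1/\<alpha> - 1/\<beta>)\<^sup>2 < (\<Sum>i=1..n+1. (1 / g i)\<^sup>2) + (1/\<alpha>)\<^sup>2 + (1/\<beta>)\<^sup>2"
    using assms(1) by (elim realizable_Sigma_2_2E) (simp, blast)
  have I: "finite {1..n+1}" "card {1..n+1} \<ge> 5" using assms(1) by auto
  from assms(2) show False
  proof
    assume w: "w \<ge> 3"
    have J: "{n-1..n+1} \<subseteq> {1..n+1}" "card {n-1..n+1} = 3" using assms(1) by auto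
    have "\<alpha> \<le> g i" if "i \<in> {n-1..n+1}" for i 
      using large[of i] that uvw w assms(1) by force
    from sum_inverse_sum_inverse_squares_bound[OF I pos J this \<beta> less(1)] less(2)
    show False by linarith
  next
    assume u: "u \<ge> 3"
    have J: "{1..3} \<subseteq> {1..n+1}" "card {1..3::nat} = 3" using assms(1) by auto
    have ge: "1 / \<beta> \<le> 1 / g i" if "i \<in> {1..3}" for i 
    proof -
      have "i \<in> {1..n+1}" using J that by blast
      hence "0 < g i" "g i < \<beta>" using pos small that u by auto
      thus ?thesis by (simp add: frac_le)
    qed
    have pos': "0 < 1 / g i" if "i \<in> {1..n+1}" for i using pos that by simp
    have "0 < 1/\<alpha>" "1/\<alpha> < 1/\<beta>" using \<beta> by (auto intro: divide_strict_left_mono)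
    \<comment> \<open>Inversion reverses the order: \<open>1/\<beta>\<close> now plays the larger
      positive root and \<open>1/\<alpha>\<close> the smaller one, and the two inequalities in
      \<open>less\<close> exchange roles.\<close>
    note bound = sum_inverse_sum_inverse_squares_bound[OF I pos' J ge this]
    have "((\<Sum>i=1..n+1. 1 / (1 / g i)) - 1/(1/\<beta>) - 1/(1/\<alpha>))\<^sup>2 \<ge>
        (\<Sum>i=1..n+1. (1 / (1 / g i))\<^sup>2) + (1/(1/\<beta>))\<^sup>2 + (1/(1/\<alpha>))\<^sup>2"
      using less(2) by (intro bound) (simp_all add: algebra_simps)
    thus False using less(1) by (simp add: algebra_simps)
  qed
qed

subsection \<open>Realizable couples\<close>

text \<open>Coefficient k of the product is \<mu> times coefficient k of \<open>Q\<close> plus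
  coefficient k - 1. These have opposite signs only at k = 2 and k = n + 2, exactly the two
  positions covered by assumptions.\<close>

lemma sign_pattern_mult_linear:
  assumes "sign_pattern Q = Sigma_pattern 2 n 2" "n \<ge> 1" "\<mu> > 0"
    and "coeff ([:\<mu>, 1:] * Q) 2 < 0" "coeff ([:\<mu>, 1:] * Q) (n + 2) < 0"
  shows "sign_pattern ([:\<mu>, 1:] * Q) = Sigma_pattern 2 (n + 1) 2"
proof -
  have Q: "degree Q = n + 3" "\<And>k. k \<le> n + 3 \<Longrightarrow> if k \<in> {2..n+1} then coeff Q k < 0 else coeff Q k > 0"
    using assms(1,2) by (auto simp: sign_pattern_Sigma_iff)
  have "Q \<noteq> 0" using Q(1) by auto
  hence deg: "degree ([:\<mu>, 1:] * Q) = n + 4" using Q(1) by (subst degree_mult_eq) auto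
  have Suc: "coeff ([:\<mu>, 1:] * Q) (Suc k) = \<mu> * coeff Q (Suc k) + coeff Q k" for k
    by simp
  have "if k \<in> {2..n+2} then coeff ([:\<mu>, 1:] * Q) k < 0 else coeff ([:\<mu>, 1:] * Q) k > 0" if "k \<le> n + 4" for k
  proof -
    have "k = 0 \<or> k = 1 \<or> k = 2 \<or> (3 \<le> k \<and> k \<le> n + 1) \<or> k = n + 2 \<or> k = n + 3 \<or> k = n + 4"
      using that by linarith
    then consider "k = 0" | "k = 1" | "k = 2" | "k \<in> {3..n+1}" | "k = n + 2" | "k = n + 3" | "k = n + 4"
      by (metis atLeastAtMost_iff)
    thus ?thesis
    proof cases
      case 4
      then obtain j where j: "k = Suc j" "j \<in> {2..n}" by (cases k) auto
      have "\<mu> * coeff Q (Suc j) < 0" "coeff Q j < 0"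
        using Q(2)[of "Suc j"] Q(2)[of j] j assms(3) by (auto simp: mult_less_0_iff)
      thus ?thesis using j by (simp only: Suc) auto
    next
      case 2
      have "\<mu> * coeff Q (Suc 0) > 0" "coeff Q 0 > 0"
        using Q(2)[of "Suc 0"] Q(2)[of 0] assms(3) by auto
      thus ?thesis using 2 by simp
    next
      case 6
      have "\<mu> * coeff Q (Suc (n+2)) > 0" "coeff Q (n+2) > 0"
        using Q(2)[of "Suc (n+2)"] Q(2)[of "n+2"] assms(3) by auto
      hence "coeff ([:\<mu>, 1:] * Q) (Suc (n+2)) > 0" unfolding Suc by linarith
      thus ?thesis using 6 by (simp add: eval_nat_numeral)
    next
      case 7
      have "coeff Q (Suc (n+3)) = 0" "coeff Q (n+3) > 0"
        using Q(1) Q(2)[of "n+3"] by (auto intro: coeff_eq_0)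
      hence "coeff ([:\<mu>, 1:] * Q) (Suc (n+3)) > 0" unfolding Suc by simp
      thus ?thesis using 7 by (simp add: eval_nat_numeral)
    qed (use assms Q(2)[of 0] in auto)
  qed
  moreover have "n + 4 = n + 1 + 3" "n + 2 = n + 1 + 1" by simp_all
  ultimately show ?thesis using deg unfolding sign_pattern_Sigma_iff[OF le_add2] by metis
qed

text \<open>For the six extremal roots alone, the middle coefficient is not controlled by the
  estimates at either end. It is obtained from the cubic with roots of order \<open>L\<close> and
  the cubic with roots of order \<open>1/L\<close>, both of signs +, +, -, -.\<close>

lemma coeff_prod_cubics_neg:
  fixes p0 p1 p2 q0 q1 q2 :: real
  assumes "0 < p0" "0 < p1" "0 < p2" "0 < q0" "0 < q1" "0 < q2"
  shows "coeff ([:-p0, -p1, p2, 1:] * [:-q0, -q1, q2, 1:]) 3 < 0"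
proof -
  have "coeff ([:-p0, -p1, p2, 1:] * [:-q0, -q1, q2, 1:]) 3 = - (p0 + p1 * q2 + p2 * q1 + q0)"
    by (simp add: eval_nat_numeral)
  moreover have "0 < p1 * q2" "0 < p2 * q1" using assms by auto
  ultimately show ?thesis using assms by linarith
qed

text \<open>Two moduli near the scale \<open>L\<close> and two near \<open>1/L\<close>, with \<open>\<alpha>\<close> and \<open>\<beta>\<close> placed among them
  according to \<open>w\<close> and \<open>u\<close>; the moduli in \<open>M\<close> are of order \<open>1\<close>. Inverting all roots exchanges \<open>u\<close> and \<open>w\<close>.\<close>

definition scaled_roots :: "nat \<Rightarrow> nat \<Rightarrow> real \<Rightarrow> real set \<Rightarrow> real set" where
  "scaled_roots u w L M = 
     {(13 - 2 * real w) * L, 1 / ((13 - 2 * real u) * L), - (10 * L), - (12 * L), - 1 / (10 * L), - 1 / (12 * L)} \<union> uminus ` M"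

section \<open>Estimates for the scaled root sets\<close>

lemma le_2_cases:
  fixes u :: nat assumes "u \<le> 2" obtains "u = 0" | "u = 1" | "u = 2"
  using assms by linarith

context
  fixes u w n :: nat and L :: real
  assumes u: "u \<le> 2" and w: "w \<le> 2" and n: "n \<ge> 1" and L: "L \<ge> 10 * real n"
begin

lemma scale_ge_10: "L \<ge> 10" 
proof -
  have "1 \<le> real n" using n by simp
  thus ?thesis using L by linarith
qed

text \<open>The listed roots are pairwise distinct, so nothing collapses in the set: the large ones
  have modulus at least 9 L, those from \<open>M\<close> lie in [-2, -1/2], and the small negative
  ones are above -1/2.\<close>

lemma scaled_roots_sum_prod_card:
  fixes f :: "real \<Rightarrow> 'a :: comm_semiring_1"
  assumes M: "finite M" "M \<subseteq> {1/2..2}"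
  shows "(\<Sum>r\<in>scaled_roots u w L M. f r) = f ((13 - 2 * real w) * L) + f (1 / ((13 - 2 * real u) * L)) 
      + f (- (10 * L)) + f (- (12 * L)) + f (- 1 / (10 * L)) + f (- 1 / (12 * L)) + (\<Sum>m\<in>M. f (- m))"
    (is ?sum)
    and "(\<Prod>r\<in>scaled_roots u w L M. f r) = f ((13 - 2 * real w) * L) * f (1 / ((13 - 2 * real u) * L)) 
      * f (- (10 * L)) * f (- (12 * L)) * f (- 1 / (10 * L)) * f (- 1 / (12 * L)) * (\<Prod>m\<in>M. f (- m))"
    (is ?prod)
    and "card (scaled_roots u w L M) = 6 + card M" (is ?card)
proof -
  have L10: "L \<ge> 10" by (rule scale_ge_10)
  define \<alpha> where "\<alpha> = (13 - 2 * real w) * L"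
  define \<beta> where "\<beta> = 1 / ((13 - 2 * real u) * L)"
  define a where "a = - 1 / (10 * L)"
  define b where "b = - 1 / (12 * L)"
  have \<alpha>: "\<alpha> \<ge> 9 * L" using w L10 by (auto simp: \<alpha>_def)
  have \<beta>: "0 < \<beta>" "\<beta> < 1" using u L10 by (cases rule: le_2_cases; auto simp: \<beta>_def field_simps)+
  have ab: "-1/2 < a" "a < b" "b < 0" using L10 by (auto simp: a_def b_def field_simps)
  have distinct: "\<alpha> \<notin> {\<beta>, - (10 * L), - (12 * L), a, b} \<union> uminus ` M" "\<beta> \<notin> {- (10 * L), - (12 * L), a, b} \<union> uminus ` M"
    "- (10 * L) \<notin> {- (12 * L), a, b} \<union> uminus ` M" "- (12 * L) \<notin> {a, b} \<union> uminus ` M" "a \<notin> {b} \<union> uminus ` M" "b \<notin> uminus ` M"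
    using \<alpha> \<beta> ab L10 M by (auto; force)+
  have eq: "scaled_roots u w L M = 
      insert \<alpha> (insert \<beta> (insert (- (10 * L)) (insert (- (12 * L)) (insert a (insert b (uminus ` M))))))"
    by (simp add: scaled_roots_def \<alpha>_def \<beta>_def a_def b_def)
  have fin: "finite (uminus ` M)" using M by simp
  show ?sum ?prod ?card
    unfolding eq unfolding \<alpha>_def[symmetric] \<beta>_def[symmetric] a_def[symmetric] b_def[symmetric]
    using distinct fin by (simp_all add: sum.reindex prod.reindex card_image add_ac mult_ac)
qed

lemma finite_scaled_roots:
  "finite M \<Longrightarrow> finite (scaled_roots u w L M)"
  by (simp add: scaled_roots_def)

lemma zero_notin_scaled_roots:
  "M \<subseteq> {1/2..2} \<Longrightarrow> 0 \<notin> scaled_roots u w L M"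
  using scale_ge_10 u w by (auto simp: scaled_roots_def)

lemma scaled_roots_sum_bounds:
  assumes M: "finite M" "M \<subseteq> {1/2..2}" "card M \<le> n"
  defines "R \<equiv> scaled_roots u w L M"
  shows "(\<Sum>r\<in>R. r) < 0" "(\<Sum>r\<in>R. r)\<^sup>2 < (\<Sum>r\<in>R. r\<^sup>2)"
proof -
  have L10: "L \<ge> 10" by (rule scale_ge_10)
  have "(\<Sum>m\<in>M. m) \<le> of_nat (card M) * 2" using M by (intro sum_bounded_above) auto
  also have "\<dots> \<le> 2 * real n" using M by simp
  finally have M_sum: "(\<Sum>m\<in>M. m) \<le> 2 * real n" .
  have M_nonneg: "0 \<le> (\<Sum>m\<in>M. m)" using M by (intro sum_nonneg) auto
  define \<beta> where "\<beta> = 1 / ((13 - 2 * real u) * L)"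
  define a where "a = 1 / (10 * L)"
  define b where "b = 1 / (12 * L)"
  have \<beta>: "0 < \<beta>" "\<beta> < a + b" 
    using u L10 by (cases rule: le_2_cases; auto simp: \<beta>_def a_def b_def field_simps)+
  have ab: "0 < a" "0 < b" "a < 1" "b < 1" using L10 by (auto simp: a_def b_def)
  have "(\<Sum>r\<in>R. r) = (13 - 2 * real w) * L + \<beta> - 10 * L - 12 * L - a - b - (\<Sum>m\<in>M. m)"
    unfolding R_def using scaled_roots_sum_prod_card(1)[OF M(1,2), of "\<lambda>r. r"] by (simp add: \<beta>_def a_def b_def sum_negf)
  hence eq: "- (\<Sum>r\<in>R. r) = 9 * L + 2 * (real w * L) + (a + b - \<beta>) + (\<Sum>m\<in>M. m)"
    by (simp add: algebra_simps)
  have wL: "0 \<le> real w * L" "real w * L \<le> 2 * L" using w L10 by auto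
  show "(\<Sum>r\<in>R. r) < 0" using eq wL \<beta> M_nonneg L10 by linarith
  \<comment> \<open>At most 13 L comes from the large roots; the small ones and \<open>M\<close>, by
    L \<ge> 10 n, add less than 2 L. Then 225 = 15 * 15 is compared with 244 = 10 * 10 + 12 *
    12.\<close>
  have "0 \<le> - (\<Sum>r\<in>R. r)" "- (\<Sum>r\<in>R. r) \<le> 15 * L"
    using eq wL \<beta> M_nonneg M_sum L10 ab L by linarith+
  hence "(- (\<Sum>r\<in>R. r))\<^sup>2 \<le> (15 * L)\<^sup>2" by (intro power_mono)
  hence "(\<Sum>r\<in>R. r)\<^sup>2 \<le> 225 * L\<^sup>2" by (simp add: power_mult_distrib)
  also have "\<dots> < 244 * L\<^sup>2" using L10 by simp
  also have "244 * L\<^sup>2 \<le> (\<Sum>r\<in>R. r\<^sup>2)"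
    unfolding R_def scaled_roots_sum_prod_card(1)[OF M(1,2), of "\<lambda>r. r\<^sup>2"]
    by (simp add: power_mult_distrib sum_nonneg)
  finally show "(\<Sum>r\<in>R. r)\<^sup>2 < (\<Sum>r\<in>R. r\<^sup>2)" .
qed

end

lemma inverse_scaled_roots: 
  "inverse ` scaled_roots u w L M = scaled_roots w u L (inverse ` M)"
  by (auto simp: scaled_roots_def image_iff inverse_eq_divide)

context
  fixes u w n :: nat and L :: real
  assumes u: "u \<le> 2" and w: "w \<le> 2" and n: "n \<ge> 1" and L: "L \<ge> 10 * real n"
begin

text \<open>The low coefficients come from the sum bounds applied to the inverted roots. The
  preceding context was closed so that its lemmas can be instantiated with \<open>u\<close> and
  \<open>w\<close> exchanged; the interval [1/2, 2] is stable under inversion.\<close>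

lemma scaled_roots_coeffs:
  assumes M: "finite M" "M \<subseteq> {1/2..2}" "card M \<le> n"
  defines "Q \<equiv> root_poly (scaled_roots u w L M)"
  shows "coeff Q (card M + 6) = 1" "coeff Q (card M + 5) > 0" "coeff Q (card M + 4) < 0" "coeff Q 2 < 0"
    "coeff Q 1 > 0" "coeff Q 0 > 0"
proof -
  define R where "R = scaled_roots u w L M"
  have fin: "finite R" and R0: "0 \<notin> R" and card: "card R = card M + 6"
    using finite_scaled_roots[OF u w n L M(1)] zero_notin_scaled_roots[OF u w n L M(2)] scaled_roots_sum_prod_card(3)[OF u w n L M(1,2)]
    by (simp_all add: R_def)
  note top = scaled_roots_sum_bounds[OF u w n L M, folded R_def]
  have inv: "finite (inverse ` M)" "inverse ` M \<subseteq> {1/2..2}" "card (inverse ` M) \<le> n"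
    using M card_image_le[OF M(1), of inverse] by (auto simp: field_simps subset_iff)
  have sum_inv: "(\<Sum>r\<in>scaled_roots w u L (inverse ` M). f r) = (\<Sum>r\<in>R. f (1/r))" for f :: "real \<Rightarrow> real"
    unfolding inverse_scaled_roots[symmetric] R_def[symmetric] 
    by (subst sum.reindex) (auto simp: inverse_eq_divide inj_on_def)
  note low = scaled_roots_sum_bounds[OF w u n L inv, unfolded sum_inv]
  have "(\<Prod>m\<in>M. m) > 0" using M by (intro prod_pos) auto
  hence prod: "(\<Prod>r\<in>R. - r) > 0"
    unfolding R_def scaled_roots_sum_prod_card(2)[OF u w n L M(1,2)]
    using u w scale_ge_10[OF u w n L] by (simp add: zero_less_mult_iff)
  have Q: "Q = root_poly R" by (simp add: Q_def R_def)
  show "coeff Q (card M + 6) = 1" using lead_coeff_root_poly[of R] card Q by simp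
  have "card R - 1 = card M + 5" "card R - 2 = card M + 4" using card by simp_all
  note top_coeffs = root_poly_top_coeffs[OF fin, unfolded this, folded Q]
  show "coeff Q (card M + 5) > 0" using top_coeffs(1) card top by simp
  show "coeff Q (card M + 4) < 0" using top_coeffs(2) card top by simp
  have "2 * coeff Q 2 < 0" 
    unfolding Q root_poly_low_coeffs(3)[OF fin R0] using prod low(2) by (simp add: mult_pos_neg)
  thus "coeff Q 2 < 0" by simp
  show "coeff Q 1 > 0" using root_poly_low_coeffs(2)[OF fin R0] prod low Q by (simp add: mult_pos_neg)
  show "coeff Q 0 > 0" using root_poly_low_coeffs(1)[OF fin R0] prod Q by simp
qed

text \<open>Induction on \<open>M\<close>: the six extremal roots give the pattern with n = 3, and
  each new root multiplies by a linear factor, with \<open>scaled_roots_coeffs\<close> for the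
  enlarged set supplying the two critical signs.\<close>

lemma sign_pattern_scaled_roots:
  assumes M: "finite M" "M \<subseteq> {1/2..2}" "card M \<le> n"
  shows "sign_pattern (root_poly (scaled_roots u w L M)) = Sigma_pattern 2 (card M + 3) 2"
  using M
proof (induction M rule: finite_induct)
  case empty
  have L10: "L \<ge> 10" by (rule scale_ge_10[OF u w n L])
  let ?Q = "root_poly (scaled_roots u w L {})"
  note coeffs = scaled_roots_coeffs[of "{}", simplified]
  define \<alpha> where "\<alpha> = (13 - 2 * real w) * L"
  define \<beta> where "\<beta> = 1 / ((13 - 2 * real u) * L)"
  define a where "a = 1 / (10 * L)"
  define b where "b = 1 / (12 * L)"
  have "?Q = [:-\<alpha>, 1:] * [:-\<beta>, 1:] * [:10*L, 1:] * [:12*L, 1:] * [:a, 1:] * [:b, 1:]"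
    unfolding root_poly_def scaled_roots_sum_prod_card(2)[OF u w n L finite.emptyI empty_subsetI]
    by (simp only: \<alpha>_def \<beta>_def a_def b_def minus_minus prod.empty mult_1_right minus_divide_left)
  also have "\<dots> = ([:-\<alpha>, 1:] * ([:10*L, 1:] * [:12*L, 1:])) * ([:-\<beta>, 1:] * ([:a, 1:] * [:b, 1:]))"
    by (simp only: mult_ac)
  also have "[:-\<alpha>, 1:] * ([:10*L, 1:] * [:12*L, 1:]) = 
      [:- (\<alpha> * (120 * L\<^sup>2)), - (22 * L * \<alpha> - 120 * L\<^sup>2), 22 * L - \<alpha>, 1:]"
    by (simp add: power2_eq_square algebra_simps)
  also have "[:-\<beta>, 1:] * ([:a, 1:] * [:b, 1:]) = [:- (\<beta> * (a * b)), - (\<beta> * (a + b) - a * b), a + b - \<beta>, 1:]"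
    by (simp add: algebra_simps)
  finally have Q: "?Q = [:- (\<alpha> * (120 * L\<^sup>2)), - (22 * L * \<alpha> - 120 * L\<^sup>2), 22 * L - \<alpha>, 1:] *
      [:- (\<beta> * (a * b)), - (\<beta> * (a + b) - a * b), a + b - \<beta>, 1:]" .
  have pos: "0 < \<alpha>" "0 < \<beta>" "0 < a" "0 < b" using u w L10 by (simp_all add: \<alpha>_def \<beta>_def a_def b_def)
  have "coeff ?Q 3 < 0"
    unfolding Q
  proof (rule coeff_prod_cubics_neg)
    have "9 * L \<le> \<alpha>" "\<alpha> \<le> 13 * L" using w L10 by (auto simp: \<alpha>_def)
    moreover have "L * (9 * L) \<le> L * \<alpha>" using \<open>9 * L \<le> \<alpha>\<close> L10 by (intro mult_left_mono) auto
    moreover have "0 < L * L" using L10 by simp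
    ultimately show "0 < 22 * L * \<alpha> - 120 * L\<^sup>2" "0 < 22 * L - \<alpha>"
      using L10 by (auto simp: power2_eq_square)
    show "0 < a + b - \<beta>" "0 < \<beta> * (a + b) - a * b"
      using u L10 by (cases rule: le_2_cases; simp add: \<beta>_def a_def b_def field_simps)+
  qed (use pos L10 in auto)
  have "degree ?Q = 6" using scaled_roots_sum_prod_card(3)[OF u w n L, of "{}"] by (simp add: degree_root_poly)
  moreover have "if k \<in> {2..4} then coeff ?Q k < 0 else coeff ?Q k > 0" if "k \<le> 6" for k
  proof -
    \<comment> \<open>With \<open>M\<close> empty, \<open>coeffs\<close> settles every position
      except 3.\<close>
    have "k \<in> {0,1,2,3,4,5,6}" using that by auto
    thus ?thesis using coeffs \<open>coeff ?Q 3 < 0\<close> by auto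
  qed
  ultimately show ?case by (subst sign_pattern_Sigma_iff) auto
next
  case (insert m M)
  let ?R = "scaled_roots u w L M"
  have eq: "scaled_roots u w L (insert m M) = insert (-m) ?R" by (auto simp: scaled_roots_def)
  have fin: "finite ?R" "finite (insert m M)" using insert by (auto intro: finite_scaled_roots[OF u w n L])
  have "card (insert (-m) ?R) = 7 + card M" 
    using scaled_roots_sum_prod_card(3)[OF u w n L fin(2)] insert unfolding eq by simp
  moreover have "card ?R = 6 + card M" 
    using scaled_roots_sum_prod_card(3)[OF u w n L insert(1)] insert by simp
  \<comment> \<open>If -m were already a root, insertion would not change the cardinality.\<close>
  ultimately have "- m \<notin> ?R" by (auto simp: insert_absorb)
  hence Q: "root_poly (scaled_roots u w L (insert m M)) = [:m, 1:] * root_poly ?R"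
    unfolding eq using root_poly_insert[OF fin(1), of "-m"] by simp
  have "sign_pattern ([:m, 1:] * root_poly ?R) = Sigma_pattern 2 ((card M + 3) + 1) 2"
  proof (rule sign_pattern_mult_linear)
    show "sign_pattern (root_poly ?R) = Sigma_pattern 2 (card M + 3) 2" using insert by simp
    show "coeff ([:m, 1:] * root_poly ?R) 2 < 0" "coeff ([:m, 1:] * root_poly ?R) (card M + 3 + 2) < 0"
      using scaled_roots_coeffs(3,4)[OF fin(2)] insert unfolding Q[symmetric] by (simp_all add: add_ac)
  qed (use insert in auto)
  thus ?case unfolding Q using insert by simp
qed

end

text \<open>The guards such as \<open>u \<noteq> 0\<close> drop the comparisons with the boundary
  values 0 and infinity, which hold automatically once \<open>g\<close> is extended to
  \<gamma>.\<close>

lemma realizable_Sigma_2_2I: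
  fixes g :: "nat \<Rightarrow> real" and \<alpha> \<beta> :: real
  assumes uvw: "u + v + w = n + 1" and n: "n \<ge> 1" and \<beta>: "0 < \<beta>" "\<beta> < \<alpha>"
    and mono: "strict_mono_on {1..n+1} g" and pos: "\<And>i. i \<in> {1..n+1} \<Longrightarrow> 0 < g i"
    and \<beta>_pos: "u \<noteq> 0 \<Longrightarrow> g u < \<beta>" "v + w \<noteq> 0 \<Longrightarrow> \<beta> < g (u + 1)"
    and \<alpha>_pos: "u + v \<noteq> 0 \<Longrightarrow> g (u + v) < \<alpha>" "w \<noteq> 0 \<Longrightarrow> \<alpha> < g (u + v + 1)"
  defines "Q \<equiv> root_poly (insert \<alpha> (insert \<beta> ((\<lambda>i. - g i) ` {1..n+1})))"
  assumes Q: "sign_pattern Q = Sigma_pattern 2 n 2"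
  shows "realizable (Sigma_pattern 2 n 2) (u, v, w)"
proof -
  let ?I = "{1..n+1}"
  define R where "R = insert \<alpha> (insert \<beta> ((\<lambda>i. - g i) ` ?I))"
  have fin: "finite R" by (simp add: R_def)
  have Q_eq: "Q = root_poly R" by (simp add: Q_def R_def)
  have roots: "poly Q x = 0 \<longleftrightarrow> x \<in> R" for x unfolding Q_eq by (rule poly_root_poly_eq_0_iff[OF fin])
  have d: "length (Sigma_pattern 2 n 2) - 1 = n + 3" "n + 3 - 2 = n + 1" "n + 3 - 1 = n + 2" 
    by (auto simp: Sigma_pattern_def)
  define \<gamma> where "\<gamma> i = (if i = 0 then 0 else if i = n + 2 then \<infinity> else ereal (g i))" for i
  have g_le: "g i \<le> g j" if "i \<in> ?I" "j \<in> ?I" "i \<le> j" for i j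
    using strict_mono_onD[OF mono that(1,2)] that(3) by (cases "i = j") auto
  have ne: "g i \<noteq> \<beta>" "g i \<noteq> \<alpha>" if i: "i \<in> ?I" for i
  proof -
    show "g i \<noteq> \<beta>"
    proof (cases "i \<le> u")
      case True
      thus ?thesis using g_le[of i u] \<beta>_pos(1) i uvw by auto
    next
      case False
      hence "u + 1 \<in> ?I" "u + 1 \<le> i" "v + w \<noteq> 0" using i uvw by auto
      thus ?thesis using g_le[OF _ i] \<beta>_pos(2) by fastforce
    qed
    show "g i \<noteq> \<alpha>"
    proof (cases "i \<le> u + v")
      case True
      hence "u + v \<in> ?I" "u + v \<noteq> 0" using i uvw by auto
      thus ?thesis using g_le[OF i _ True] \<alpha>_pos(1) by fastforce
    next
      case False
      thus ?thesis using g_le[of "u+v+1" i] \<alpha>_pos(2) i uvw by auto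
    qed
  qed
  have abs_image: "abs ` (\<lambda>i. - g i) ` ?I = g ` ?I"
    unfolding image_image using pos by (intro image_cong) (auto simp: abs_of_pos)
  have "inj_on abs ((\<lambda>i. - g i) ` ?I)"
    using pos by (auto simp: inj_on_def abs_of_pos)
  moreover have "\<alpha> \<notin> g ` ?I" "\<beta> \<notin> g ` ?I" using ne by blast+
  ultimately have inj: "inj_on abs R"
    unfolding R_def inj_on_insert using \<beta> abs_image by auto
  have "distinct_moduli Q"
    using inj rsquarefree_root_poly[OF fin] by (simp add: distinct_moduli_def roots flip: Q_eq)
  moreover have "hyperbolic Q" unfolding Q_eq by (rule hyperbolic_root_poly[OF fin])
  moreover have "degree Q = n + 3" using Q n by (simp add: sign_pattern_Sigma_iff)
  moreover have N_neg: "\<forall>x\<in>(\<lambda>i. - g i) ` ?I. x < 0" using pos by simp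
  have "{x. poly Q x = 0 \<and> x > 0} = {\<beta>, \<alpha>}"
    unfolding roots R_def insert_iff using \<beta> less_trans[OF \<beta>] N_neg less_asym by blast
  moreover have neg: "{x. poly Q x = 0 \<and> x < 0} = (\<lambda>i. - g i) ` ?I"
    unfolding roots R_def insert_iff using \<beta> less_trans[OF \<beta>] N_neg less_asym by blast
  have "\<gamma> ` ?I = (\<lambda>x. ereal \<bar>x\<bar>) ` {x. poly Q x = 0 \<and> x < 0}"
    unfolding neg image_image using pos by (intro image_cong) (auto simp: \<gamma>_def abs_of_pos)
  moreover have "strict_mono_on ?I \<gamma>"
    using strict_mono_onD[OF mono] by (intro strict_mono_onI) (auto simp: \<gamma>_def)
  moreover have "\<gamma> 0 = 0" "\<gamma> (n + 2) = \<infinity>" by (simp_all add: \<gamma>_def)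
  moreover have "\<gamma> u < ereal \<beta>" "ereal \<beta> < \<gamma> (u + 1)" "\<gamma> (u + v) < ereal \<alpha>" "ereal \<alpha> < \<gamma> (u + v + 1)"
  proof -
    have "v + w \<noteq> 0 \<longleftrightarrow> u + 1 \<noteq> n + 2" "w \<noteq> 0 \<longleftrightarrow> u + v + 1 \<noteq> n + 2" "u \<noteq> n + 2" "u + v \<noteq> n + 2" 
      using uvw by auto
    thus "\<gamma> u < ereal \<beta>" "ereal \<beta> < \<gamma> (u + 1)" "\<gamma> (u + v) < ereal \<alpha>" "ereal \<alpha> < \<gamma> (u + v + 1)"
      using \<beta> \<beta>_pos \<alpha>_pos unfolding \<gamma>_def by auto
  qed
  ultimately show ?thesis
    unfolding realizable_def Let_def prod.case d using uvw Q \<beta>(2) by blast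
qed

lemma realizable_Sigma_2_2:
  assumes n: "n \<ge> 4" and uvw: "u + v + w = n + 1" and u: "u \<le> 2" and w: "w \<le> 2"
  shows "realizable (Sigma_pattern 2 n 2) (u, v, w)"
proof -
  define L where "L = 10 * real n"
  have L: "L \<ge> 40" using n by (simp add: L_def)
  \<comment> \<open>The factors 13, 11, 9 for w = 0, 1, 2 leave exactly w of 10 L and 12 L above
    \<alpha>; likewise exactly u of 1/(12 L) and 1/(10 L) lie below \<beta>.\<close>
  define \<alpha> where "\<alpha> = (13 - 2 * real w) * L"
  define \<beta> where "\<beta> = 1 / ((13 - 2 * real u) * L)"
  \<comment> \<open>The middle moduli are spread increasingly over (1, 2); the n - 3 indices 3..n-1
    match the offset in \<open>card M + 3\<close>.\<close>
  define h where "h i = 1 + (real i - 2) / real n" for i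
  define M where "M = h ` {3..n-1}"
  define g where "g i = (if i = 1 then 1 / (12 * L) else if i = 2 then 1 / (10 * L)
    else if i = n then 10 * L else if i = n + 1 then 12 * L else h i)" for i
  have h: "1 < h i" "h i < 2" if "i \<in> {3..n-1}" for i using that n by (auto simp: h_def)
  have h_mono: "h i < h j" if "i < j" for i j using that n by (simp add: h_def divide_strict_right_mono)
  have I: "{1..n+1} = {1, 2, n, n+1} \<union> {3..n-1}" using n by auto
  have g: "g 1 = 1 / (12 * L)" "g 2 = 1 / (10 * L)" "g n = 10 * L" "g (n+1) = 12 * L" 
    "\<And>i. i \<in> {3..n-1} \<Longrightarrow> g i = h i"
    using n by (auto simp: g_def)
  have small: "1 / (12 * L) < 1 / (10 * L)" "1 / (10 * L) < 1" "0 < 1 / (12 * L)" using L by (auto simp: field_simps)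
  have "g i < g (Suc i)" if "i \<in> {1..n}" for i
  proof -
    have "i = 1 \<or> i = 2 \<or> (3 \<le> i \<and> i + 1 \<le> n - 1) \<or> (i = n - 1 \<and> 3 \<le> i) \<or> i = n" using that n by auto
    thus ?thesis
    proof (elim disjE conjE)
      assume "i = 1"
      hence "g i = 1 / (12 * L)" "g (Suc i) = 1 / (10 * L)" using g(1,2) by (simp_all add: numeral_2_eq_2)
      thus ?thesis using small(1) by (simp only:)
    next
      assume "i = 2" 
      moreover have "g 3 = h 3" "1 < h 3" using n g(5)[of 3] h(1)[of 3] by auto
      ultimately have "g i = 1 / (10 * L)" "g (Suc i) = h 3" "1 < h 3" 
        using g(2) by (simp_all add: eval_nat_numeral)
      thus ?thesis using small(2) by linarith
    next
      assume "3 \<le> i" "i + 1 \<le> n - 1"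
      thus ?thesis using g(5)[of i] g(5)[of "Suc i"] h_mono[of i "Suc i"] by auto
    next
      assume i: "i = n - 1" "3 \<le> i"
      hence "g i < 2" using g(5)[of i] h(2)[of i] by auto
      moreover have "g (Suc i) = 10 * L" using i n g(3) by auto
      ultimately show ?thesis using L by simp
    next
      assume "i = n" thus ?thesis using g(3,4) L by simp
    qed
  qed
  hence step: "g i < g (Suc i)" if "1 \<le> i" "i < n + 1" for i using that by auto
  have mono: "strict_mono_on {1..n+1} g"
  proof (rule strict_mono_onI)
    fix i j assume ij: "i \<in> {1..n+1}" "j \<in> {1..n+1}" "i < j"
    from ij(3,2) show "g i < g j"
    proof (induction j)
      case (Suc j)
      thus ?case using step[of j] ij(1) by (cases "i = j") auto
    qed simp
  qed
  have pos: "0 < g i" if "i \<in> {1..n+1}" for i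
    using that small L h(1) unfolding I by (auto simp: g_def intro: less_trans[OF zero_less_one])
  have \<beta>: "0 < \<beta>" "\<beta> < 1" using u L by (cases rule: le_2_cases; auto simp: \<beta>_def field_simps)+
  have \<alpha>: "9 * L \<le> \<alpha>" using w L by (auto simp: \<alpha>_def)
  have M: "finite M" "M \<subseteq> {1/2..2}" "card M \<le> n" "card M + 3 = n"
  proof -
    show "finite M" by (simp add: M_def)
    show "M \<subseteq> {1/2..2}" using h unfolding M_def by (force simp: less_imp_le)
    have "inj_on h {3..n-1}" using h_mono by (intro inj_onI) (metis linorder_neqE_nat less_irrefl)
    thus "card M + 3 = n" using n by (simp add: M_def card_image)
    thus "card M \<le> n" by simp
  qed
  have "(\<lambda>i. - g i) ` {1..n+1} = {- (12 * L), - (10 * L), - 1 / (10 * L), - 1 / (12 * L)} \<union> uminus ` M"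
    unfolding I image_Un M_def image_image using g by (auto simp: image_iff)
  hence roots: "insert \<alpha> (insert \<beta> ((\<lambda>i. - g i) ` {1..n+1})) = scaled_roots u w L M"
    unfolding scaled_roots_def \<alpha>_def \<beta>_def by auto
  have pattern: "sign_pattern (root_poly (scaled_roots u w L M)) = Sigma_pattern 2 n 2"
    using sign_pattern_scaled_roots[OF u w _ _ M(1-3)] M(4) n by (simp add: L_def)
  have g3: "1 < g 3" 
    using h(1)[of 3] n by (simp add: g_def)
  have gn: "g (n - 1) < 2" 
    using h(2)[of "n-1"] g(5)[of "n-1"] n by simp
  show ?thesis
  proof (rule realizable_Sigma_2_2I[OF uvw _ \<beta>(1) _ mono pos])
    show "\<beta> < \<alpha>" using \<alpha> \<beta> L by linarith
    show "u \<noteq> 0 \<Longrightarrow> g u < \<beta>"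
      using u L g(1,2) by (cases rule: le_2_cases) (auto simp: \<beta>_def divide_strict_left_mono)
    show "\<beta> < g (u + 1)"
    proof (cases "u = 2")
      case True
      thus ?thesis using \<beta>(2) g3 by simp
    next
      case False
      hence "u = 0 \<or> u = 1" using u by auto
      thus ?thesis using L g(1,2) 
        by (auto simp: \<beta>_def divide_strict_left_mono eval_nat_numeral)
    qed
    have uv: "u + v = n + 1 - w" using uvw by simp
    \<comment> \<open>For w = 0, 1, 2 the index u + v is n + 1, n, n - 1, so the comparisons are 12
      L < 13 L, 10 L < 11 L, and a value below 2 against 9 L.\<close>
    show "g (u + v) < \<alpha>" unfolding uv
      using w L g(3,4) gn by (cases rule: le_2_cases) (auto simp: \<alpha>_def)
    show "w \<noteq> 0 \<Longrightarrow> \<alpha> < g (u + v + 1)" unfolding uv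
      using w L g(3,4) n by (cases rule: le_2_cases) (auto simp: \<alpha>_def)
    show "sign_pattern (root_poly (insert \<alpha> (insert \<beta> ((\<lambda>i. - g i) ` {1..n + 1})))) = Sigma_pattern 2 n 2"
      unfolding roots by (rule pattern)
  qed (use n in auto)
qed

theorem theorem2:
  fixes n u v w :: nat
  assumes "n \<ge> 4" and "u + v + w = n + 1"
  shows "(u \<le> 2 \<and> w \<le> 2 \<longrightarrow> realizable (Sigma_pattern 2 n 2) (u, v, w)) \<and>
         (u \<ge> 3 \<or> w \<ge> 3 \<longrightarrow> \<not> realizable (Sigma_pattern 2 n 2) (u, v, w))"
  using assms realizable_Sigma_2_2 not_realizable_Sigma_2_2 by blast

end
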